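(* The number of permutations in a cross equivalence class (of $\mathcal{S}_n$, for any $n\ge 1$) is a power of $2$.
   Context: $\mathcal{S}_n$ is the set of permutations of $\{1,\ldots,n\}$, viewed as words $u=u_1\cdots u_n$. For $u\in\mathcal{S}_n$ with inverse $s=u^{-1}$ (so $s_i$ is the position of the letter $i$ in $u$) and $1\le i\le n-1$, $i^+(u)$ is the multiset of distances $\{|s_i-s_j|: i+1\le j\le n\}$. Two permutations $u,v\in\mathcal{S}_n$ are cross equivalent, written $u\sim_+v$, if $i^+(u)=i^+(v)$ (as multisets) for all $1\le i\le n-1$. A cross equivalence class is an equivalence class of $\sim_+$ on $\mathcal{S}_n$. "Power of $2$" includes $2^0=1$. *)

theory Defs
  imports "HOL-Combinatorics.Permutations" "HOL-Library.Multiset"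
begin

text \<open>
  The word \<open>u\<^sub>1 \<cdots> u\<^sub>n\<close> is represented by the function \<open>u permutes {1..n}\<close> with
  \<open>u k = u\<^sub>k\<close>, so \<open>inv u i\<close> is the position of the letter \<open>i\<close>. Such a function is the identity
  outside \<open>{1..n}\<close>, hence it is determined by its word.
\<close>

definition perms :: "nat \<Rightarrow> (nat \<Rightarrow> nat) set" where
  "perms n = {u. u permutes {1..n}}"

definition cross_dist :: "nat \<Rightarrow> (nat \<Rightarrow> nat) \<Rightarrow> nat \<Rightarrow> int multiset" where
  "cross_dist n u i = image_mset (\<lambda>j. \<bar>int (inv u i) - int (inv u j)\<bar>) (mset_set {i + 1..n})"

definition cross_equiv :: "nat \<Rightarrow> ((nat \<Rightarrow> nat) \<times> (nat \<Rightarrow> nat)) set" where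
  "cross_equiv n = {(u, v). u \<in> perms n \<and> v \<in> perms n \<and>
     (\<forall>i\<in>{1..n - 1}. cross_dist n u i = cross_dist n v i)}"

lemma equiv_cross_equiv: "equiv (perms n) (cross_equiv n)"
  by (rule equivI) (auto simp: cross_equiv_def refl_on_def intro: symI transI)

end

theory Submission
  imports Defs
begin

text \<open>
  Read a permutation as the list \<open>s\<^sub>1, \<dots>, s\<^sub>n\<close> of the positions of its letters, and regard
  the positions as points of \<open>\<int>\<close>. The data \<open>i\<^sup>+\<close> are then the distances from \<open>s\<^sub>i\<close> to
  the set \<open>S\<^sub>i\<^sub>+\<^sub>1\<close>, where \<open>S\<^sub>i = {s\<^sub>i, \<dots>, s\<^sub>n}\<close>.

  The main observation (\<open>dists_eq_imp_symmetric\<close>) is that two different points see a finite set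
  \<open>A \<subseteq> \<int>\<close> at the same multiset of distances only if the reflection exchanging the two points
  preserves \<open>A\<close>. Adding the letters in the order \<open>n, n - 1, \<dots>, 1\<close>, it follows that
  \<open>u \<sim>\<^sub>+ v\<close> holds exactly when, for each \<open>i\<close>, some isometry of \<open>\<int>\<close> carries \<open>S\<^sub>i\<close> and
  its marked point \<open>s\<^sub>i\<close> for \<open>u\<close> to the same data for \<open>v\<close>.

  A class is now counted by removing letters in the opposite order, starting from
  \<open>S\<^sub>1 = {1, \<dots>, n}\<close>. Once \<open>S\<^sub>i\<close> has been chosen for \<open>v\<close>, the admissible \<open>s\<^sub>i\<close> are the
  images of the marked point of \<open>u\<close> under the isometries carrying one \<open>S\<^sub>i\<close> to the other. Up to
  one such isometry they form an orbit of the stabiliser of a nonempty finite set, and that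
  stabiliser contains at most one reflection besides the identity. So there are one or two
  choices, and their number depends on \<open>u\<close> and \<open>i\<close> only, not on the earlier choices. The size of
  the class is the product of these numbers.
\<close>

section \<open>Isometries of the integers\<close>

definition int_isometry :: "(int \<Rightarrow> int) \<Rightarrow> bool" where
  "int_isometry g \<longleftrightarrow> (\<exists>c. g = (\<lambda>x. x + c) \<or> g = (\<lambda>x. c - x))"

lemma int_isometry_id: "int_isometry id"
  unfolding int_isometry_def by (intro exI[of _ 0]) auto

lemma int_isometry_reflection: "int_isometry (\<lambda>x. c - x)"
  unfolding int_isometry_def by blast

lemma int_isometry_comp:
  assumes "int_isometry g" "int_isometry h"
  shows "int_isometry (h \<circ> g)"
proof -
  from assms obtain c d where
    "g = (\<lambda>x. x + c) \<or> g = (\<lambda>x. c - x)" "h = (\<lambda>x. x + d) \<or> h = (\<lambda>x. d - x)"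
    unfolding int_isometry_def by blast
  then have "h \<circ> g = (\<lambda>x. x + (c + d)) \<or> h \<circ> g = (\<lambda>x. (c + d) - x)
      \<or> h \<circ> g = (\<lambda>x. (d - c) - x) \<or> h \<circ> g = (\<lambda>x. x + (d - c))"
    by (auto simp: fun_eq_iff)
  then show ?thesis
    unfolding int_isometry_def by blast
qed

lemma int_isometry_inverse:
  assumes "int_isometry g"
  obtains h where "int_isometry h" "h \<circ> g = id" "g \<circ> h = id"
proof -
  from assms obtain c where "g = (\<lambda>x. x + c) \<or> g = (\<lambda>x. c - x)"
    unfolding int_isometry_def by blast
  then show thesis
  proof
    assume "g = (\<lambda>x. x + c)"
    moreover have "int_isometry (\<lambda>x. x + (- c))"
      unfolding int_isometry_def by blast
    ultimately show thesis
      by (intro that[of "\<lambda>x. x + (- c)"]) (auto simp: fun_eq_iff)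
  next
    assume "g = (\<lambda>x. c - x)"
    then show thesis
      by (intro that[of g] assms) (auto simp: fun_eq_iff)
  qed
qed

lemma int_isometry_inj: "int_isometry g \<Longrightarrow> inj g"
  unfolding int_isometry_def by (auto simp: inj_def)

lemma int_isometry_abs_diff: "int_isometry g \<Longrightarrow> \<bar>g x - g y\<bar> = \<bar>x - y\<bar>"
  unfolding int_isometry_def by auto

text \<open>
  A translation preserving a nonempty finite set is trivial, and a reflection preserving it
  exchanges its minimum and its maximum.
\<close>

lemma int_isometry_stabiliser:
  assumes g: "int_isometry g" and A: "finite A" "A \<noteq> {}" and gA: "g ` A = A"
  shows "g x = x \<or> g x = Min A + Max A - x"
proof -
  from g obtain c where "g = (\<lambda>x. x + c) \<or> g = (\<lambda>x. c - x)"
    unfolding int_isometry_def by blast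
  then show ?thesis
  proof
    assume [simp]: "g = (\<lambda>x. x + c)"
    have "Max A + c \<in> A" "Min A + c \<in> A"
      using gA Max_in[OF A] Min_in[OF A] by auto
    then have "Max A + c \<le> Max A" "Min A \<le> Min A + c"
      using A(1) by (blast intro: Max_ge Min_le)+
    then show ?thesis by simp
  next
    assume [simp]: "g = (\<lambda>x. c - x)"
    have "c - Max A \<in> A" "c - Min A \<in> A"
      using gA Max_in[OF A] Min_in[OF A] by auto
    then have "Min A \<le> c - Max A" "c - Min A \<le> Max A"
      using A by auto
    then show ?thesis by simp
  qed
qed

section \<open>Distances from a point to a finite set\<close>

definition dists :: "int \<Rightarrow> int set \<Rightarrow> int multiset" where
  "dists x A = image_mset (\<lambda>a. \<bar>x - a\<bar>) (mset_set A)"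

lemma dists_isometry:
  assumes "int_isometry g"
  shows "dists (g x) (g ` A) = dists x A"
proof -
  have "mset_set (g ` A) = image_mset g (mset_set A)"
    using int_isometry_inj[OF assms]
    by (metis image_mset_mset_set inj_on_subset subset_UNIV)
  then show ?thesis
    by (simp add: dists_def image_mset.compositionality o_def int_isometry_abs_diff[OF assms])
qed

text \<open>
  The convention that \<open>d = 0\<close> counts \<open>x\<close> twice makes the right-hand side uniform in \<open>d\<close>, of
  either sign.
\<close>

lemma count_dists:
  assumes "finite A"
  shows "(if d = 0 then 2 else 1) * int (count (dists x A) \<bar>d\<bar>)
    = of_bool (x + d \<in> A) + of_bool (x - d \<in> A)"
proof -
  have "count (dists x A) \<bar>d\<bar> = card {a \<in> A. \<bar>x - a\<bar> = \<bar>d\<bar>}"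
    using assms by (simp add: dists_def count_image_mset_eq_card_vimage eq_commute)
  also have "{a \<in> A. \<bar>x - a\<bar> = \<bar>d\<bar>} = A \<inter> {x + d, x - d}"
    by (auto simp: abs_if split: if_splits)
  finally show ?thesis
    by (auto simp: Int_insert_right)
qed

text \<open>
  Let \<open>f\<close> be the indicator function of \<open>A\<close>. Equality of the distances means
  \<open>f (x + d) + f (x - d) = f (y + d) + f (y - d)\<close> for all \<open>d\<close>, and this says that the defect of
  symmetry \<open>f a - f (x + y - a)\<close> has period \<open>y - x\<close>. A periodic function of finite support
  vanishes.
\<close>

lemma dists_eq_imp_symmetric:
  assumes A: "finite A" and eq: "dists x A = dists y A" and "x \<noteq> y"
  shows "(\<lambda>a. (x + y) - a) ` A = A"
proof -
  define f where "f a = (of_bool (a \<in> A) :: int)" for a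
  define g where "g a = f a - f (x + y - a)" for a
  define S where "S = {a. g a \<noteq> 0}"
  have f_eq: "f (x + d) + f (x - d) = f (y + d) + f (y - d)" for d
    using count_dists[OF A, of d x] count_dists[OF A, of d y] eq by (simp add: f_def)
  have period: "g (a + (y - x)) = g a" for a
    using f_eq[of "a - x"] by (simp add: g_def algebra_simps)
  have "S \<subseteq> A \<union> (\<lambda>a. (x + y) - a) ` A"
  proof
    fix a assume "a \<in> S"
    then have "a \<in> A \<or> x + y - a \<in> A"
      by (auto simp: S_def g_def f_def of_bool_def split: if_splits)
    then show "a \<in> A \<union> (\<lambda>a. (x + y) - a) ` A"
      by (auto intro!: image_eqI[of _ _ "x + y - a"])
  qed
  then have fin: "finite S"
    using A finite_subset by blast
  have "(\<lambda>a. a + (y - x)) ` S \<subseteq> S"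
    using period by (auto simp: S_def)
  then have shift: "(\<lambda>a. a + (y - x)) ` S = S"
    using fin by (intro endo_inj_surj) auto
  \<comment> \<open>A finite set invariant under a nonzero translation is empty: compare the sums.\<close>
  have "\<Sum>S = (\<Sum>a\<in>S. a + (y - x))"
    by (subst shift[symmetric]) (simp add: sum.reindex)
  then have "int (card S) * (y - x) = 0"
    by (simp add: sum.distrib)
  with \<open>x \<noteq> y\<close> fin have "S = {}"
    by simp
  then have "g a = 0" for a
    unfolding S_def by blast
  then have sym: "x + y - a \<in> A" if "a \<in> A" for a
    using that unfolding g_def f_def by (metis eq_iff_diff_eq_0 of_bool_eq_iff)
  show ?thesis
  proof
    show "(\<lambda>a. (x + y) - a) ` A \<subseteq> A"
      using sym by blast
    show "A \<subseteq> (\<lambda>a. (x + y) - a) ` A"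
    proof
      fix a assume "a \<in> A"
      then show "a \<in> (\<lambda>a. (x + y) - a) ` A"
        by (intro image_eqI[of _ _ "x + y - a"] sym) simp_all
    qed
  qed
qed

corollary dists_eq_imp_isometry:
  assumes "finite A" "dists x A = dists y A"
  obtains h where "int_isometry h" "h ` A = A" "h x = y"
proof (cases "x = y")
  case True
  then show thesis
    using that[of id] int_isometry_id by simp
next
  case False
  then show thesis
    using that[of "\<lambda>a. (x + y) - a"] int_isometry_reflection dists_eq_imp_symmetric assms
    by simp
qed

section \<open>Lists of points with the same distances to later points\<close>

fun same_dists :: "int list \<Rightarrow> int list \<Rightarrow> bool" where
  "same_dists [] [] \<longleftrightarrow> True"
| "same_dists (x # s) (y # t) \<longleftrightarrow> dists x (set s) = dists y (set t) \<and> same_dists s t"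
| "same_dists _ _ \<longleftrightarrow> False"

text \<open>
  An isometry between the tails carries \<open>x\<close> to a point at the same distances from \<open>set t\<close> as
  \<open>y\<close>; if that point is not \<open>y\<close>, a symmetry of \<open>set t\<close> corrects it. The isometry between the
  tails comes from the same argument applied to their own heads and tails.
\<close>

lemma same_dists_Cons_imp_isometry:
  assumes "same_dists s t" "dists x (set s) = dists y (set t)"
  obtains g where "int_isometry g" "g ` set s = set t" "g x = y"
  using assms
proof (induction s t arbitrary: x y thesis rule: same_dists.induct)
  case 1
  show ?case
    by (rule 1(1)[of "\<lambda>a. (x + y) - a"]) (auto intro: int_isometry_reflection)
next
  case (2 x' s y' t)
  from 2(3) obtain g where g: "int_isometry g" "g ` set s = set t" "g x' = y'"
    by (auto elim: 2(1)[rotated])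
  then have image: "g ` set (x' # s) = set (y' # t)"
    by simp
  have "dists (g x) (set (y' # t)) = dists y (set (y' # t))"
    using 2(4) dists_isometry[OF g(1), of x "set (x' # s)"] image by simp
  then obtain h where h: "int_isometry h" "h ` set (y' # t) = set (y' # t)" "h (g x) = y"
    using dists_eq_imp_isometry[of "set (y' # t)"] by blast
  have "(h \<circ> g) ` set (x' # s) = set (y' # t)"
    using image h(2) by (simp only: image_comp[symmetric])
  moreover have "(h \<circ> g) x = y"
    using h(3) by simp
  ultimately show ?case
    using 2(2)[OF int_isometry_comp[OF g(1) h(1)]] by blast
qed auto

definition isometric_images :: "int \<Rightarrow> int set \<Rightarrow> int set \<Rightarrow> int set" where
  "isometric_images x A B = {g x | g. int_isometry g \<and> g ` A = B}"

text \<open>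
  Given the set \<open>set (y # t)\<close> and the condition on the tails, the head is constrained only
  through isometries of whole sets. This is what allows the heads to be counted before the tails
  are chosen.
\<close>

lemma same_dists_Cons_iff:
  assumes "x \<notin> set s" "y \<notin> set t"
  shows "same_dists (x # s) (y # t) \<longleftrightarrow>
    y \<in> isometric_images x (set (x # s)) (set (y # t)) \<and> same_dists s t"
proof
  assume "same_dists (x # s) (y # t)"
  then have st: "same_dists s t" "dists x (set s) = dists y (set t)"
    by auto
  then obtain g where "int_isometry g" "g ` set s = set t" "g x = y"
    by (rule same_dists_Cons_imp_isometry)
  with st(1) show "y \<in> isometric_images x (set (x # s)) (set (y # t)) \<and> same_dists s t"
    unfolding isometric_images_def by force
next
  assume R: "y \<in> isometric_images x (set (x # s)) (set (y # t)) \<and> same_dists s t"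
  then obtain g where g: "int_isometry g" "g ` insert x (set s) = insert y (set t)" "g x = y"
    by (auto simp: isometric_images_def)
  have "g ` (insert x (set s) - {x}) = insert y (set t) - {y}"
    using int_isometry_inj[OF g(1)] g(2,3) by (simp only: image_set_diff) simp
  then have "g ` set s = set t"
    using assms by simp
  then have "dists x (set s) = dists y (set t)"
    using dists_isometry[OF g(1), of x "set s"] g(3) by simp
  with R show "same_dists (x # s) (y # t)"
    by simp
qed

text \<open>
  Composing with a fixed isometry between \<open>A\<close> and \<open>B\<close> identifies the images with the orbit of
  \<open>x\<close> under the stabiliser of \<open>A\<close>, whatever \<open>B\<close> is.
\<close>

lemma card_isometric_images:
  assumes g: "int_isometry g" "g ` A = B"
  shows "card (isometric_images x A B) = card (isometric_images x A A)"
proof -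
  obtain h where h: "int_isometry h" "h \<circ> g = id" "g \<circ> h = id"
    using int_isometry_inverse[OF g(1)] .
  have hB: "h ` B = A"
    using g(2) h(2) by (metis image_comp image_id id_apply)
  have "isometric_images x A B = g ` isometric_images x A A"
  proof
    show "isometric_images x A B \<subseteq> g ` isometric_images x A A"
    proof
      fix y assume "y \<in> isometric_images x A B"
      then obtain k where k: "int_isometry k" "k ` A = B" "y = k x"
        by (auto simp: isometric_images_def)
      have "(h \<circ> k) ` A = A"
        using k(2) hB by (metis image_comp)
      then have "(h \<circ> k) x \<in> isometric_images x A A"
        using int_isometry_comp[OF k(1) h(1)] unfolding isometric_images_def by blast
      moreover have "y = g ((h \<circ> k) x)"
        using k(3) h(3) by (simp add: fun_eq_iff)
      ultimately show "y \<in> g ` isometric_images x A A"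
        by blast
    qed
    show "g ` isometric_images x A A \<subseteq> isometric_images x A B"
    proof
      fix y assume "y \<in> g ` isometric_images x A A"
      then obtain k where k: "int_isometry k" "k ` A = A" "y = (g \<circ> k) x"
        by (auto simp: isometric_images_def)
      moreover have "(g \<circ> k) ` A = B"
        using k(2) g(2) by (metis image_comp)
      ultimately show "y \<in> isometric_images x A B"
        using int_isometry_comp[OF k(1) g(1)] unfolding isometric_images_def by blast
    qed
  qed
  then show ?thesis
    using int_isometry_inj[OF g(1)] by (simp add: card_image inj_on_subset)
qed

lemma card_isometric_images_self:
  assumes "finite A" "A \<noteq> {}"
  obtains e :: nat where "card (isometric_images x A A) = 2 ^ e"
proof -
  let ?I = "isometric_images x A A"
  have sub: "?I \<subseteq> {x, Min A + Max A - x}"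
    using int_isometry_stabiliser[OF _ assms] by (fastforce simp: isometric_images_def)
  have "x \<in> ?I"
    using int_isometry_id unfolding isometric_images_def mem_Collect_eq
    by (intro exI[of _ id]) simp
  with sub have "?I = {x} \<or> ?I = {x, Min A + Max A - x}"
    by blast
  then have "card ?I = 2 ^ 0 \<or> card ?I = 2 ^ 1"
    by (cases "x = Min A + Max A - x") auto
  then show thesis
    using that by blast
qed

text \<open>
  The exponent must not depend on the isometric copy \<open>B\<close> of \<open>set s\<close>: different choices of the
  head of \<open>t\<close> leave different copies for the tail, and the count is a product only because all of
  these give the same number of tails.
\<close>

lemma card_same_dists_power_of_2:
  assumes "distinct s"
  shows "\<exists>k::nat. \<forall>B. (\<exists>g. int_isometry g \<and> g ` set s = B) \<longrightarrow>
    card {t. distinct t \<and> set t = B \<and> same_dists s t} = 2 ^ k"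
  using assms
proof (induction s)
  case Nil
  have "{t. distinct t \<and> set t = {} \<and> same_dists [] t} = {[]}"
    by auto
  then show ?case
    by (intro exI[of _ 0]) auto
next
  case (Cons x s)
  define T where "T B = {t. distinct t \<and> set t = B \<and> same_dists s t}" for B
  obtain k where k: "\<And>g B. int_isometry g \<Longrightarrow> g ` set s = B \<Longrightarrow> card (T B) = 2 ^ k"
    using Cons by (auto simp: T_def)
  obtain e where e: "card (isometric_images x (set (x # s)) (set (x # s))) = 2 ^ e"
    by (rule card_isometric_images_self[of "set (x # s)" x]) auto
  have "card {t. distinct t \<and> set t = B \<and> same_dists (x # s) t} = 2 ^ (e + k)"
    if g: "int_isometry g" "g ` set (x # s) = B" for g B
  proof -
    define I where "I = isometric_images x (set (x # s)) B"
    have cardI: "card I = 2 ^ e"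
      using card_isometric_images[OF g] e by (simp add: I_def)
    then have "finite I"
      by (simp add: card_ge_0_finite)
    have "I \<subseteq> B"
      by (auto simp: I_def isometric_images_def)
    have cardT: "card (T (B - {y})) = 2 ^ k" if y: "y \<in> I" for y
    proof -
      obtain h where h: "int_isometry h" "h ` set (x # s) = B" "h x = y"
        using y by (auto simp: I_def isometric_images_def)
      have "h ` (set (x # s) - {x}) = B - {y}"
        using int_isometry_inj[OF h(1)] h(2,3) by (simp only: image_set_diff) simp
      then have "h ` set s = B - {y}"
        using Cons.prems by simp
      then show ?thesis
        using k h(1) by blast
    qed
    have "{t. distinct t \<and> set t = B \<and> same_dists (x # s) t}
        = (\<lambda>(y, t). y # t) ` (SIGMA y:I. T (B - {y}))" (is "?L = ?R")
    proof
      show "?L \<subseteq> ?R"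
      proof
        fix l assume l: "l \<in> ?L"
        then obtain y t where [simp]: "l = y # t"
          by (cases l) auto
        have "y \<in> I" "t \<in> T (B - {y})"
          using l same_dists_Cons_iff[of x s y t] Cons.prems by (auto simp: I_def T_def)
        then show "l \<in> ?R"
          by force
      qed
      show "?R \<subseteq> ?L"
      proof
        fix l assume "l \<in> ?R"
        then obtain y t where l: "l = y # t" and y: "y \<in> I" and t: "t \<in> T (B - {y})"
          by auto
        have dist: "distinct t" "y \<notin> set t" "set (y # t) = B"
          using t y \<open>I \<subseteq> B\<close> by (auto simp: T_def)
        then have "same_dists (x # s) (y # t)"
          using same_dists_Cons_iff[of x s y t] Cons.prems y t by (simp add: I_def T_def)
        with dist show "l \<in> ?L"
          by (simp add: l)
      qed
    qed
    moreover have "inj_on (\<lambda>(y, t). y # t) (SIGMA y:I. T (B - {y}))"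
      by (auto simp: inj_on_def)
    ultimately have "card {t. distinct t \<and> set t = B \<and> same_dists (x # s) t}
        = card (SIGMA y:I. T (B - {y}))"
      by (simp add: card_image)
    also have "\<dots> = (\<Sum>y\<in>I. card (T (B - {y})))"
      using \<open>finite I\<close> cardT by (intro card_SigmaI) (auto intro: card_ge_0_finite)
    also have "\<dots> = 2 ^ (e + k)"
      by (simp add: cardT cardI power_add)
    finally show ?thesis .
  qed
  then show ?case
    by blast
qed

section \<open>Permutations as lists of positions\<close>

definition position_list :: "nat \<Rightarrow> (nat \<Rightarrow> nat) \<Rightarrow> int list" where
  "position_list n u = map (\<lambda>i. int (inv u i)) [1..<Suc n]"

lemma bij_betw_position_list:
  "bij_betw (position_list n) (perms n) {t. distinct t \<and> set t = int ` {1..n}}"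
  unfolding bij_betw_def
proof
  show "inj_on (position_list n) (perms n)"
  proof (rule inj_onI)
    fix u v assume u: "u \<in> perms n" and v: "v \<in> perms n"
      and eq: "position_list n u = position_list n v"
    have "inv u i = inv v i" for i
    proof (cases "i \<in> {1..n}")
      case True
      then show ?thesis
        using eq by (auto simp: position_list_def)
    next
      case False
      have "inv w i = i" if "w \<in> perms n" for w
        using that False by (intro permutes_not_in[OF permutes_inv]) (auto simp: perms_def)
      with u v show ?thesis
        by simp
    qed
    then have "inv u = inv v"
      by (rule ext)
    moreover have "inv (inv u) = u" "inv (inv v) = v"
      using u v permutes_inv_inv unfolding perms_def by blast+
    ultimately show "u = v"
      by metis
  qed
  show "position_list n ` perms n = {t. distinct t \<and> set t = int ` {1..n}}"
  proof
    show "position_list n ` perms n \<subseteq> {t. distinct t \<and> set t = int ` {1..n}}"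
    proof
      fix t assume "t \<in> position_list n ` perms n"
      then obtain u where u: "u permutes {1..n}" and t: "t = position_list n u"
        by (auto simp: perms_def)
      have inv: "inv u permutes {1..n}"
        using u by (rule permutes_inv)
      have "distinct t"
        using permutes_inj[OF inv]
        by (auto simp: t position_list_def distinct_map inj_on_def inj_def)
      moreover have "set t = int ` inv u ` {1..n}"
        by (auto simp: t position_list_def)
      ultimately show "t \<in> {t. distinct t \<and> set t = int ` {1..n}}"
        using permutes_image[OF inv] by simp
    qed
    show "{t. distinct t \<and> set t = int ` {1..n}} \<subseteq> position_list n ` perms n"
    proof
      fix t assume "t \<in> {t. distinct t \<and> set t = int ` {1..n}}"
      then have t: "distinct t" "set t = int ` {1..n}"
        by auto
      have len: "length t = n"
        using distinct_card[OF t(1)] t(2) by (simp add: card_image)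
      define q where "q i = (if i \<in> {1..n} then nat (t ! (i - 1)) else i)" for i
      have int_q: "int (q i) = t ! (i - 1)" if "i \<in> {1..n}" for i
      proof -
        have "t ! (i - 1) \<in> set t"
          using that len by (intro nth_mem) auto
        then have "0 \<le> t ! (i - 1)"
          unfolding t(2) by auto
        with that show ?thesis
          by (simp add: q_def)
      qed
      have map_q: "map (\<lambda>i. int (q i)) [1..<Suc n] = t"
      proof (rule nth_equalityI)
        fix i assume "i < length (map (\<lambda>i. int (q i)) [1..<Suc n])"
        then have "i < n" by (simp del: upt_Suc)
        then show "map (\<lambda>i. int (q i)) [1..<Suc n] ! i = t ! i"
          using int_q[of "Suc i"] by (simp del: upt_Suc)
      qed (simp add: len del: upt_Suc)
      have range: "{1..n} = set [1..<Suc n]"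
        by auto
      have "int ` q ` {1..n} = set (map (\<lambda>i. int (q i)) [1..<Suc n])"
        by (simp only: range set_map image_image)
      then have "int ` q ` {1..n} = int ` {1..n}"
        unfolding map_q t(2) .
      then have img: "q ` {1..n} = {1..n}"
        by (simp only: inj_image_eq_iff[OF inj_of_nat])
      then have "bij_betw q {1..n} {1..n}"
        by (simp add: bij_betw_def eq_card_imp_inj_on)
      then have q: "q permutes {1..n}"
        by (rule bij_imp_permutes) (simp only: q_def if_False)
      then have "position_list n (inv q) = t"
        using map_q by (simp only: position_list_def permutes_inv_inv[OF q])
      moreover have "inv q \<in> perms n"
        using q by (simp add: perms_def permutes_inv)
      ultimately show "t \<in> position_list n ` perms n"
        by blast
    qed
  qed
qed

lemma same_dists_map_upt:
  "same_dists (map p [m..<Suc n]) (map q [m..<Suc n]) \<longleftrightarrow>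
    (\<forall>i\<in>{m..n}. dists (p i) (p ` {i + 1..n}) = dists (q i) (q ` {i + 1..n}))"
proof (induction "Suc n - m" arbitrary: m)
  case 0
  then show ?case by auto
next
  case (Suc d)
  then have m: "m \<le> n" by simp
  then have "[m..<Suc n] = m # [Suc m..<Suc n]"
    by (intro upt_conv_Cons) simp
  moreover have "{m..n} = insert m {Suc m..n}"
    using m by auto
  moreover have "set [Suc m..<Suc n] = {m + 1..n}"
    by auto
  ultimately show ?case
    using Suc.hyps(1)[of "Suc m"] Suc.hyps(2)
    by (simp only: list.map same_dists.simps set_map ball_simps)
qed

lemma cross_equiv_iff_same_dists:
  assumes "u \<in> perms n" "v \<in> perms n"
  shows "(u, v) \<in> cross_equiv n \<longleftrightarrow> same_dists (position_list n u) (position_list n v)"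
proof -
  let ?p = "\<lambda>u i. int (inv u i)"
  have cross: "cross_dist n w i = dists (?p w i) (?p w ` {i + 1..n})" if "w \<in> perms n" for w i
  proof -
    have "inj (inv w)"
      using that permutes_inj permutes_inv by (auto simp: perms_def)
    then have "inj_on (?p w) {i + 1..n}"
      by (auto simp: inj_on_def inj_def)
    then have "mset_set (?p w ` {i + 1..n}) = image_mset (?p w) (mset_set {i + 1..n})"
      by (simp add: image_mset_mset_set)
    then show ?thesis
      by (simp add: cross_dist_def dists_def image_mset.compositionality o_def)
  qed
  \<comment> \<open>The last letter has no later letters, so including it adds no condition.\<close>
  have "(\<forall>i\<in>{1..n}. cross_dist n u i = cross_dist n v i) \<longleftrightarrow>
      (\<forall>i\<in>{1..n - 1}. cross_dist n u i = cross_dist n v i)" (is "?all \<longleftrightarrow> ?init")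
  proof
    assume ?init
    show ?all
    proof
      fix i assume "i \<in> {1..n}"
      then have "i \<in> {1..n - 1} \<or> i = n" by auto
      then show "cross_dist n u i = cross_dist n v i"
        using \<open>?init\<close> by (auto simp: cross_dist_def)
    qed
  qed auto
  then show ?thesis
    using assms unfolding position_list_def same_dists_map_upt cross_equiv_def
    by (simp add: cross)
qed

theorem corollary1:
  fixes n :: nat and C :: "(nat \<Rightarrow> nat) set"
  assumes "n \<ge> 1"
    and "C \<in> perms n // cross_equiv n"
  shows "\<exists>k::nat. card C = 2 ^ k"
proof -
  from assms(2) obtain u where u: "u \<in> perms n" and C: "C = cross_equiv n `` {u}"
    by (auto simp: quotient_def)
  let ?s = "position_list n u"
  have bij: "inj_on (position_list n) (perms n)"
      "position_list n ` perms n = {t. distinct t \<and> set t = int ` {1..n}}"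
    using bij_betw_position_list[of n] by (auto simp: bij_betw_def)
  with u have s: "distinct ?s" "set ?s = int ` {1..n}"
    by blast+
  have C': "C = {v \<in> perms n. same_dists ?s (position_list n v)}"
    using cross_equiv_iff_same_dists[OF u] by (auto simp: C cross_equiv_def)
  then have "position_list n ` C = {t \<in> position_list n ` perms n. same_dists ?s t}"
    by blast
  then have "position_list n ` C = {t. distinct t \<and> set t = set ?s \<and> same_dists ?s t}"
    unfolding bij(2) s(2) by blast
  moreover have "inj_on (position_list n) C"
    using bij(1) C' by (auto intro: inj_on_subset)
  ultimately have "card C = card {t. distinct t \<and> set t = set ?s \<and> same_dists ?s t}"
    by (metis card_image)
  moreover obtain k where
    "\<And>g B. int_isometry g \<Longrightarrow> g ` set ?s = B \<Longrightarrow>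
      card {t. distinct t \<and> set t = B \<and> same_dists ?s t} = 2 ^ k"
    using card_same_dists_power_of_2[OF s(1)] by blast
  from this[OF int_isometry_id] have
    "card {t. distinct t \<and> set t = set ?s \<and> same_dists ?s t} = 2 ^ k"
    by simp
  ultimately show ?thesis
    by auto
qed

end
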